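(* Let $r\ge1$ be an integer. Define numbers $q_1,\dots,q_{r+2}$ by $q_{r+2}=F^{(r)}_2$ and, for $k=1,\dots,r+1$, $$q_{r+2-k}=F^{(r)}_{k+2}-\sum_{j=1}^{k}F^{(r)}_{k+2-j}\,q_{r+3-j}$$ (i.e. $q_{r+1}=F^{(r)}_3-F^{(r)}_2q_{r+2}$, $q_r=F^{(r)}_4-F^{(r)}_3q_{r+2}-F^{(r)}_2q_{r+1}$, ..., $q_1=F^{(r)}_{r+3}-F^{(r)}_{r+2}q_{r+2}-\cdots-F^{(r)}_2q_2$). Let $Q_{r+2}$ be the $(r+2)\times(r+2)$ matrix with $(Q_{r+2})_{i,i+1}=1$ for $1\le i\le r+1$, last row $(q_1,q_2,\dots,q_{r+2})$, and all other entries $0$. For an integer $n$, let $A_{r,n}$ be the $(r+2)\times(r+2)$ matrix with entries $(A_{r,n})_{i,j}=F^{(r)}_{n+i+j-2}$. Then for every integer $n\ge0$, $$A_{r,n}=Q_{r+2}^{\,n}A_{r,0}.$$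
   Context: Let $(F_k)_{k\ge0}$ be the Fibonacci numbers, $F_0=0$, $F_1=1$, $F_{k+2}=F_{k+1}+F_k$. The hyperfibonacci numbers are defined for $k\ge 0$ by $F^{(0)}_k=F_k$ and, for $r\ge1$, $F^{(r)}_k=\sum_{j=0}^{k}F^{(r-1)}_j$ (so $F^{(r)}_0=0$, $F^{(r)}_1=1$). *)

theory Defs
  imports "HOL-Number_Theory.Fib" "Jordan_Normal_Form.Matrix"
begin

fun hyperfib :: "nat \<Rightarrow> nat \<Rightarrow> nat" where
  "hyperfib 0 k = fib k"
| "hyperfib (Suc r) k = (\<Sum>j=0..k. hyperfib r j)"

(* The coefficients q_1, ..., q_{r+2}: both prescribed cases are read off from one equation,
   with k = r + 2 - i (so the sum is empty for i = r + 2). Only arguments i in {1..r+2} are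
   meaningful; see hyperfib_q_top and hyperfib_q_rec below. *)
function hyperfib_q :: "nat \<Rightarrow> nat \<Rightarrow> int" where
  "hyperfib_q r i =
     int (hyperfib r ((r + 2 - i) + 2))
     - (\<Sum>j=1..r + 2 - i. int (hyperfib r ((r + 2 - i) + 2 - j)) * hyperfib_q r (r + 3 - j))"
  by pat_completeness auto
termination
  by (relation "measure (\<lambda>(r, i). r + 2 - i)") auto

declare hyperfib_q.simps [simp del]

lemma hyperfib_q_top: "hyperfib_q r (r + 2) = int (hyperfib r 2)"
  by (subst hyperfib_q.simps) (simp add: numeral_2_eq_2)

lemma hyperfib_q_rec:
  assumes "k \<in> {1..r + 1}"
  shows "hyperfib_q r (r + 2 - k) =
    int (hyperfib r (k + 2))
    - (\<Sum>j=1..k. int (hyperfib r (k + 2 - j)) * hyperfib_q r (r + 3 - j))"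
proof -
  have "r + 2 - (r + 2 - k) = k"
    using assms by auto
  then show ?thesis
    by (subst hyperfib_q.simps) (simp only:)
qed

(* Matrix indices start at 0 here, so the usual 1-based entry (i, j) is (i - 1, j - 1) below. *)
definition hyperfib_Q :: "nat \<Rightarrow> int mat" where
  "hyperfib_Q r = mat (r + 2) (r + 2)
     (\<lambda>(i, j). if i = r + 1 then hyperfib_q r (j + 1) else if j = i + 1 then 1 else 0)"

definition hyperfib_A :: "nat \<Rightarrow> nat \<Rightarrow> int mat" where
  "hyperfib_A r n = mat (r + 2) (r + 2) (\<lambda>(i, j). int (hyperfib r (n + i + j)))"

end

theory Submission
  imports Defs "HOL-Computational_Algebra.Formal_Power_Series"
begin

(* The generating function of the r-th hyperfibonacci sequence is x / ((1 - x - x^2) (1 - x)^r).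
   The denominator has degree r + 2, so comparing coefficients of x^m yields a linear recurrence of
   order r + 2 which, as the numerator is x, holds already from m = 2 on. The equations for
   m = 2, ..., r + 3 are triangular with F_1 = 1 and are exactly the ones that define the q_i, so the
   q_i are the coefficients of this recurrence. Hence the companion matrix Q maps A n to A (n + 1). *)

definition hyperfib_fps :: "nat \<Rightarrow> int fps" where
  "hyperfib_fps r = Abs_fps (\<lambda>k. int (hyperfib r k))"

definition hyperfib_denom :: "nat \<Rightarrow> int fps" where
  "hyperfib_denom r = (1 - fps_X - fps_X ^ 2) * (1 - fps_X) ^ r"

lemma hyperfib_0_right [simp]: "hyperfib r 0 = 0"
  by (induction r) auto

lemma hyperfib_1_right [simp]: "hyperfib r (Suc 0) = 1"
  by (induction r) (simp_all add: atLeast0_atMost_Suc)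

text \<open>Partial summation of coefficients is multiplication by 1/(1 - x), so each increment of r
  contributes one factor 1 - x to the denominator.\<close>

lemma hyperfib_fps_Suc: "(1 - fps_X) * hyperfib_fps (Suc r) = hyperfib_fps r"
proof (rule fps_ext)
  fix n
  show "fps_nth ((1 - fps_X) * hyperfib_fps (Suc r)) n = fps_nth (hyperfib_fps r) n"
    by (cases n) (simp_all add: hyperfib_fps_def left_diff_distrib)
qed

lemma hyperfib_fps_0: "(1 - fps_X - fps_X ^ 2) * hyperfib_fps 0 = fps_X"
proof (rule fps_ext)
  fix n :: nat
  consider "n = 0" | "n = 1" | m where "n = Suc (Suc m)"
    by (metis One_nat_def not0_implies_Suc)
  then show "fps_nth ((1 - fps_X - fps_X ^ 2) * hyperfib_fps 0) n = fps_nth fps_X n"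
    by cases (simp_all add: hyperfib_fps_def left_diff_distrib power2_eq_square mult.assoc)
qed

lemma hyperfib_denom_mult: "hyperfib_denom r * hyperfib_fps r = fps_X"
proof (induction r)
  case 0
  then show ?case by (simp add: hyperfib_denom_def hyperfib_fps_0)
next
  case (Suc r)
  have "hyperfib_denom (Suc r) * hyperfib_fps (Suc r)
      = hyperfib_denom r * ((1 - fps_X) * hyperfib_fps (Suc r))"
    by (simp add: hyperfib_denom_def mult_ac)
  then show ?case by (simp only: hyperfib_fps_Suc Suc.IH)
qed

lemma hyperfib_denom_nth_0: "fps_nth (hyperfib_denom r) 0 = 1"
  by (simp add: hyperfib_denom_def fps_nth_power_0)

text \<open>The degree is 2 for r = 0, and each further factor 1 - x raises it by one.\<close>

lemma hyperfib_denom_nth_gt: "m > r + 2 \<Longrightarrow> fps_nth (hyperfib_denom r) m = 0"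
proof (induction r arbitrary: m)
  case 0
  then show ?case by (simp add: hyperfib_denom_def fps_X_power_iff)
next
  case (Suc r)
  have *: "hyperfib_denom (Suc r) = hyperfib_denom r - fps_X * hyperfib_denom r"
    by (simp add: hyperfib_denom_def algebra_simps)
  from Suc.prems show ?case
    by (simp add: * Suc.IH)
qed

text \<open>Coefficient m of \<open>hyperfib_denom_mult\<close>, solved for the summand j = 0, whose
  factor is 1. Letting j run up to m serves both uses: m \<le> r + 3 to identify the q_i, and m
  \<ge> r + 2 for the recurrence of fixed order.\<close>

lemma hyperfib_denom_rec:
  assumes "m \<ge> 2"
  shows "int (hyperfib r m) = (\<Sum>j=1..m. - fps_nth (hyperfib_denom r) j * int (hyperfib r (m - j)))"
proof -
  have "(\<Sum>j=0..m. fps_nth (hyperfib_denom r) j * int (hyperfib r (m - j))) = fps_nth fps_X m"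
    by (simp flip: hyperfib_denom_mult[of r] add: fps_mult_nth hyperfib_fps_def)
  also have "\<dots> = 0"
    using assms by simp
  finally show ?thesis
    by (simp add: sum.atLeast_Suc_atMost hyperfib_denom_nth_0 sum_negf)
qed

text \<open>Strong induction along the triangular system: the equation for m = j + 1 determines the
  j-th coefficient from the earlier ones, just as the definition of \<open>hyperfib_q\<close>
  does.\<close>

lemma hyperfib_q_eq_denom:
  assumes "j \<in> {1..r + 2}"
  shows "hyperfib_q r (r + 3 - j) = - fps_nth (hyperfib_denom r) j"
  using assms
proof (induction j rule: less_induct)
  case (less j)
  then obtain k where k: "j = Suc k" "k \<le> r + 1"
    by (cases j) auto
  then have i: "r + 2 - (r + 3 - j) = k"
    by auto
  \<comment> \<open>In the recurrence at m = k + 2, the summand k + 2 vanishes because F_0 = 0, and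
    the summand k + 1 = j has factor F_1 = 1.\<close>
  have "int (hyperfib r (k + 2)) =
      (\<Sum>j=1..k. - fps_nth (hyperfib_denom r) j * int (hyperfib r (k + 2 - j))) - fps_nth (hyperfib_denom r) j"
    by (subst hyperfib_denom_rec) (simp_all add: k)
  also have "(\<Sum>j=1..k. - fps_nth (hyperfib_denom r) j * int (hyperfib r (k + 2 - j))) =
      (\<Sum>j=1..k. int (hyperfib r (k + 2 - j)) * hyperfib_q r (r + 3 - j))"
    using k by (intro sum.cong) (auto simp: less.IH)
  finally show ?case
    by (subst hyperfib_q.simps) (simp only: i)
qed

lemma hyperfib_recurrence:
  "int (hyperfib r (n + r + 2)) =
     (\<Sum>i<r + 2. hyperfib_q r (i + 1) * int (hyperfib r (n + i)))"
proof -
  have "int (hyperfib r (n + r + 2)) = (\<Sum>j=1..n + r + 2.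
      - fps_nth (hyperfib_denom r) j * int (hyperfib r (n + r + 2 - j)))"
    by (rule hyperfib_denom_rec) simp
  \<comment> \<open>The range can be cut at r + 2, the degree of the denominator.\<close>
  also have "\<dots> = (\<Sum>j=1..r + 2. - fps_nth (hyperfib_denom r) j * int (hyperfib r (n + r + 2 - j)))"
    by (rule sum.mono_neutral_right) (auto simp: hyperfib_denom_nth_gt)
  also have "\<dots> = (\<Sum>j=1..r + 2. hyperfib_q r (r + 3 - j) * int (hyperfib r (n + r + 2 - j)))"
    by (intro sum.cong refl) (simp only: hyperfib_q_eq_denom)
  \<comment> \<open>Reversal of the summation order by i = r + 2 - j.\<close>
  also have "\<dots> = (\<Sum>i<r + 2. hyperfib_q r (i + 1) * int (hyperfib r (n + i)))"
    by (rule sum.reindex_bij_witness[of _ "\<lambda>i. r + 2 - i" "\<lambda>j. r + 2 - j"])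
      (auto simp: Suc_diff_le numeral_3_eq_3)
  finally show ?thesis .
qed

text \<open>The rows of Q above the last shift the rows of A up by one, which raises n by one since
  the entries depend only on n + i + j. The last row applies the recurrence to each column.\<close>

lemma hyperfib_Q_mult_A: "hyperfib_Q r * hyperfib_A r n = hyperfib_A r (Suc n)"
proof (rule eq_matI)
  fix i j
  assume "i < dim_row (hyperfib_A r (Suc n))" "j < dim_col (hyperfib_A r (Suc n))"
  then have ij: "i < r + 2" "j < r + 2"
    by (simp_all add: hyperfib_A_def)
  have "(hyperfib_Q r * hyperfib_A r n) $$ (i, j) =
      (\<Sum>k<r + 2. (if i = r + 1 then hyperfib_q r (k + 1) else if k = i + 1 then 1 else 0)
         * int (hyperfib r (n + k + j)))"
    using ij unfolding hyperfib_Q_def hyperfib_A_def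
    by (simp add: scalar_prod_def lessThan_atLeast0 del: sum.op_ivl_Suc)
  also have "\<dots> = int (hyperfib r (Suc n + i + j))"
  proof (cases "i = r + 1")
    case True
    then show ?thesis
      using hyperfib_recurrence[of r "n + j"] by (simp add: ac_simps del: sum.lessThan_Suc)
  next
    case False
    then show ?thesis
      using ij by (simp add: if_distrib[of "\<lambda>x. x * _"] sum.delta cong: if_cong del: sum.lessThan_Suc)
  qed
  finally show "(hyperfib_Q r * hyperfib_A r n) $$ (i, j) = hyperfib_A r (Suc n) $$ (i, j)"
    using ij by (simp add: hyperfib_A_def)
qed (simp_all add: hyperfib_Q_def hyperfib_A_def)

text \<open>The offset m is kept general because the power unfolds as Q^n * Q: the rightmost Q is
  absorbed into A, so the induction hypothesis is needed at \<open>Suc m\<close>.\<close>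

lemma hyperfib_Q_pow_mult_A: "hyperfib_Q r ^\<^sub>m n * hyperfib_A r m = hyperfib_A r (n + m)"
proof (induction n arbitrary: m)
  case 0
  show ?case by (simp add: hyperfib_Q_def hyperfib_A_def)
next
  case (Suc n)
  have Q: "hyperfib_Q r \<in> carrier_mat (r + 2) (r + 2)"
    by (simp add: hyperfib_Q_def)
  have A: "hyperfib_A r m \<in> carrier_mat (r + 2) (r + 2)"
    by (simp add: hyperfib_A_def)
  have "hyperfib_Q r ^\<^sub>m Suc n * hyperfib_A r m =
      hyperfib_Q r ^\<^sub>m n * (hyperfib_Q r * hyperfib_A r m)"
    using assoc_mult_mat[OF pow_carrier_mat[OF Q] Q A] by simp
  then show ?case
    by (simp add: hyperfib_Q_mult_A Suc.IH)
qed

theorem theorem1: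
  fixes r n :: nat
  assumes "r \<ge> 1"
  shows "hyperfib_A r n = (hyperfib_Q r ^\<^sub>m n) * hyperfib_A r 0"
  by (simp add: hyperfib_Q_pow_mult_A)

end
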